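(* Let $\{\gamma_n\}_{n\ge1}$ be a sequence of positive real numbers. Let $\{\mathcal K_n(x)\}_{n\ge0}$ and $\{\tilde{\mathcal K}_n(x)\}_{n\ge0}$ be the kernel polynomial systems obtained, respectively, from the symmetric polynomials $\{\mathcal S_n\}$ with coefficients $\{\gamma_n\}$ and from the symmetric polynomials $\{\tilde S_n\}$ with the pairwise interchanged coefficients $\{\gamma_2,\gamma_1,\gamma_4,\gamma_3,\dots\}$ (see context). If $$\gamma_{2n+1}-\gamma_{2n-1}=\gamma_{2n+2}-\gamma_{2n},\qquad n\ge1,$$ then the kernel polynomial system is invariant under this perturbation, that is, $\tilde{\mathcal K}_n(x)=\mathcal K_n(x)$ for all $n\ge0$.
   Context: The polynomials $\mathcal S_n$ are defined by $\mathcal S_n(x)=x\mathcal S_{n-1}(x)-\gamma_n\mathcal S_{n-2}(x)$, $n\ge1$, $\mathcal S_{-1}=0$, $\mathcal S_0=1$. They satisfy $\mathcal S_n(-x)=(-1)^n\mathcal S_n(x)$, and $\mathcal P_n$, $\mathcal K_n$ are defined by $\mathcal S_{2n}(x)=\mathcal P_n(x^2)$, $\mathcal S_{2n+1}(x)=x\mathcal K_n(x^2)$; $\{\mathcal K_n\}$ is the monic kernel polynomial system of $\{\mathcal P_n\}$ based at the origin. Similarly, $\tilde S_n(x)=x\tilde S_{n-1}(x)-\tilde\nu_n\tilde S_{n-2}(x)$, $n\ge1$, $\tilde S_{-1}=0$, $\tilde S_0=1$, with $\tilde\nu_{2j}=\gamma_{2j-1}$ ($j\ge1$) and $\tilde\nu_{2j+1}=\gamma_{2j+2}$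 ($j\ge0$), and $\tilde{\mathcal K}_n$ is defined by $\tilde S_{2n+1}(x)=x\tilde{\mathcal K}_n(x^2)$. The passage from $\{\mathcal S_n\}$ to $\{\tilde S_n\}$ is how the paper realises the passage from a chain sequence with parameters $g_n=\gamma_{2n+1}/(\gamma_{2n+1}+\gamma_{2n+2})$ to the (generalised) complementary one with parameters $1-g_n$. *)

theory Defs
  imports Complex_Main "HOL-Computational_Algebra.Polynomial"
begin

text \<open>
  Coefficient sequences are indexed from 1; the value at index 0 is never used.
  The second equation is the recurrence at \<open>n = 1\<close>, where \<open>c 1\<close> multiplies the
  polynomial of index \<open>-1\<close>, which is 0.
\<close>

fun sym_poly :: "(nat \<Rightarrow> real) \<Rightarrow> nat \<Rightarrow> real poly" where
  "sym_poly c 0 = 1"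
| "sym_poly c (Suc 0) = [:0, 1:] * sym_poly c 0 - smult (c 1) 0"
| "sym_poly c (Suc (Suc n)) =
     [:0, 1:] * sym_poly c (Suc n) - smult (c (Suc (Suc n))) (sym_poly c n)"

definition kernel_poly :: "(nat \<Rightarrow> real) \<Rightarrow> nat \<Rightarrow> real poly" where
  "kernel_poly c n =
     (THE K. sym_poly c (2 * n + 1) = [:0, 1:] * pcompose K ([:0, 1:] ^ 2))"

text \<open>The sequence \<open>\<gamma> 2, \<gamma> 1, \<gamma> 4, \<gamma> 3, \<dots>\<close> at the indices \<open>1, 2, 3, 4, \<dots>\<close>.\<close>

definition interchange :: "(nat \<Rightarrow> real) \<Rightarrow> nat \<Rightarrow> real" where
  "interchange c n = (if even n then c (n - 1) else c (n + 1))"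

lemma interchange_even: "j \<ge> 1 \<Longrightarrow> interchange c (2 * j) = c (2 * j - 1)"
  by (simp add: interchange_def)

lemma interchange_odd: "interchange c (2 * j + 1) = c (2 * j + 2)"
  by (simp add: interchange_def)

text \<open>The description in \<open>kernel_poly\<close> determines a unique polynomial.\<close>

lemma sym_poly_even_odd_parts:
  "\<exists>P K. sym_poly c (2 * n) = pcompose P ([:0, 1:] ^ 2) \<and>
         sym_poly c (2 * n + 1) = [:0, 1:] * pcompose K ([:0, 1:] ^ 2)"
proof (induction n)
  case 0
  have "sym_poly c (2 * 0) = pcompose 1 ([:0, 1:] ^ 2)"
    by (simp add: pcompose_1)
  moreover have "sym_poly c (2 * 0 + 1) = [:0, 1:] * pcompose 1 ([:0, 1:] ^ 2)"
    by (simp add: pcompose_1)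
  ultimately show ?case by blast
next
  case (Suc n)
  let ?q = "[:0, 1:] ^ 2 :: real poly"
  obtain P K where P: "sym_poly c (2 * n) = pcompose P ?q"
    and K: "sym_poly c (2 * n + 1) = [:0, 1:] * pcompose K ?q"
    using Suc by blast
  define P' where "P' = [:0, 1:] * K - smult (c (2 * n + 2)) P"
  define K' where "K' = P' - smult (c (2 * n + 3)) K"
  have X: "pcompose [:0, 1:] ?q = [:0, 1:] ^ 2"
    by (simp add: pcompose_pCons)
  have "sym_poly c (2 * n + 2) = pcompose P' ?q"
    using P K unfolding P'_def
    by (simp only: pcompose_diff pcompose_mult pcompose_smult X)
       (simp add: power2_eq_square)
  moreover from this have "sym_poly c (2 * n + 3) = [:0, 1:] * pcompose K' ?q"
    using K unfolding K'_def
    by (simp only: pcompose_diff pcompose_smult)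
       (simp add: numeral_3_eq_3 smult_diff_right)
  moreover have "2 * Suc n = 2 * n + 2" "2 * Suc n + 1 = 2 * n + 3"
    by simp_all
  ultimately show ?case
    by metis
qed

lemma kernel_poly_unique:
  fixes K L :: "real poly"
  assumes "[:0, 1:] * pcompose K ([:0, 1:] ^ 2) = [:0, 1:] * pcompose L ([:0, 1:] ^ 2)"
  shows "K = L"
proof -
  have "pcompose (K - L) ([:0, 1:] ^ 2) = 0"
    using assms by (simp add: pcompose_diff)
  moreover have "degree ([:0, 1:] ^ 2 :: real poly) > 0"
    by (simp add: degree_power_eq)
  ultimately have "K - L = 0"
    by (metis pcompose_eq_0)
  then show ?thesis by simp
qed

lemma sym_poly_odd:
  "sym_poly c (2 * n + 1) = [:0, 1:] * pcompose (kernel_poly c n) ([:0, 1:] ^ 2)"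
proof -
  obtain K where K: "sym_poly c (2 * n + 1) = [:0, 1:] * pcompose K ([:0, 1:] ^ 2)"
    using sym_poly_even_odd_parts by blast
  show ?thesis
    unfolding kernel_poly_def
    by (rule theI[of _ K]) (use K in \<open>auto intro: kernel_poly_unique\<close>)
qed

end

theory Submission
  imports Defs
begin

text \<open>
  Eliminating the even-indexed polynomials shows that the odd-indexed ones depend on the
  coefficients only through the sums \<open>c (2n + 2) + c (2n + 3)\<close> and the products
  \<open>c (2n + 1) * c (2n + 2)\<close>. Interchanging within the pairs preserves the products, and the
  hypothesis says precisely that it preserves the sums.
\<close>

text \<open>Write S_k for \<open>sym_poly c k\<close>. Expand S_(m+4) twice, then run the recurrence
  backwards: x S_(m+1) = S_(m+2) + \<open>c (m + 2)\<close> S_m.\<close>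

lemma sym_poly_two_step:
  "sym_poly c (m + 4) =
     ([:0, 1:] ^ 2 - [:c (m + 3) + c (m + 4):]) * sym_poly c (m + 2)
     - smult (c (m + 2) * c (m + 3)) (sym_poly c m)"
  by (rule poly_ext) (simp add: eval_nat_numeral algebra_simps)

lemma sym_poly_odd_cong:
  assumes sums: "\<And>n. c (2 * n + 2) + c (2 * n + 3) = d (2 * n + 2) + d (2 * n + 3)"
    and prods: "\<And>n. c (2 * n + 1) * c (2 * n + 2) = d (2 * n + 1) * d (2 * n + 2)"
  shows "sym_poly c (2 * n + 1) = sym_poly d (2 * n + 1)"
proof (induction n rule: induct_nat_012)
  case 0
  show ?case by simp
next
  \<comment> \<open>S_3 = x (x^2 - (\<open>c 2 + c 3\<close>)), so the first sum settles this second
    initial value.\<close>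
  case 1
  show ?case
    using sums[of 0] by (simp add: eval_nat_numeral algebra_simps)
next
  case (ge2 n)
  have idx: "2 * Suc n + 1 = (2 * n + 1) + 2" "2 * Suc (Suc n) + 1 = (2 * n + 1) + 4"
    by simp_all
  have "c ((2 * n + 1) + 3) + c ((2 * n + 1) + 4) = d ((2 * n + 1) + 3) + d ((2 * n + 1) + 4)"
    using sums[of "n + 1"] by (simp add: eval_nat_numeral)
  moreover have "c ((2 * n + 1) + 2) * c ((2 * n + 1) + 3) = d ((2 * n + 1) + 2) * d ((2 * n + 1) + 3)"
    using prods[of "n + 1"] by (simp add: eval_nat_numeral)
  ultimately show ?case
    using ge2 unfolding idx sym_poly_two_step by simp
qed

theorem corollary3p2:
  fixes \<gamma> :: "nat \<Rightarrow> real"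
  assumes "\<And>n. n \<ge> 1 \<Longrightarrow> \<gamma> n > 0"
    and "\<And>n. n \<ge> 1 \<Longrightarrow> \<gamma> (2 * n + 1) - \<gamma> (2 * n - 1) = \<gamma> (2 * n + 2) - \<gamma> (2 * n)"
  shows "\<forall>n. kernel_poly (interchange \<gamma>) n = kernel_poly \<gamma> n"
proof -
  \<comment> \<open>The left side is \<open>\<gamma> (2 * n + 1) + \<gamma> (2 * n + 4)\<close>:
    this is the hypothesis at \<open>n + 1\<close>, rearranged.\<close>
  have "interchange \<gamma> (2 * n + 2) + interchange \<gamma> (2 * n + 3) = \<gamma> (2 * n + 2) + \<gamma> (2 * n + 3)" for n
    using assms(2)[of "n + 1"] interchange_even[of "n + 1" \<gamma>] interchange_odd[of \<gamma> "n + 1"]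
    by (simp add: eval_nat_numeral)
  moreover have
    "interchange \<gamma> (2 * n + 1) * interchange \<gamma> (2 * n + 2) = \<gamma> (2 * n + 1) * \<gamma> (2 * n + 2)" for n
    by (simp add: interchange_def)
  ultimately have "sym_poly (interchange \<gamma>) (2 * n + 1) = sym_poly \<gamma> (2 * n + 1)" for n
    by (rule sym_poly_odd_cong)
  then show ?thesis
    unfolding kernel_poly_def by simp
qed

end
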